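(* Let $t\ge 3$ and $p\ge 2$ be integers, let $K_p^{(t)}$ be the complete $t$-partite graph with all parts of size $p$, and let $e$ be an edge of it. Then $$\dot E_{ISI}(K_p^{(t)}-e)>\dot E_{ISI}(K_p^{(t)})$$ for every pair $(t,p)$ except $(t,p)=(3,2)$. For the exceptional graph, $$\dot E_{ISI}(K_{2,2,2}-e)\approx 15.816551<16=\dot E_{ISI}(K_{2,2,2}).$$ Equivalently: (1) if $t=3$, the $ISI$ energy decreases upon deletion of $e$ for $p=2$ and increases for every $p\ge 3$; (2) if $t\ge 4$, the $ISI$ energy increases for every $p\ge 2$.
   Context: For a finite simple graph $G$ with vertices $v_1,\dots,v_n$ of degrees $d_1,\dots,d_n$, the inverse sum indeg matrix $ISI(G)$ is the $n\times n$ real symmetric matrix whose $(i,j)$ entry is $\frac{d_id_j}{d_i+d_j}$ if $v_i$ and $v_j$ are adjacent, and $0$ otherwise. The $ISI$ energy $\dot E_{ISI}(G)$ is the sum of the absolute values of the eigenvalues of $ISI(G)$. $G-e$ is obtained by deleting the edge $e$ (keeping all vertices); $ISI(G-e)$ is computed with the degrees of $G-e$. *)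

theory Defs
  imports Complex_Main "Jordan_Normal_Form.Char_Poly"
begin

text \<open>A finite simple graph with \<open>n\<close> vertices is given by its order \<open>n\<close>, with vertex set
  \<open>{0..<n}\<close>, and by its set \<open>E\<close> of edges, which are two-element sets of vertices.\<close>

definition simple_graph :: "nat \<Rightarrow> nat set set \<Rightarrow> bool" where
  "simple_graph n E \<longleftrightarrow> (\<forall>e\<in>E. e \<subseteq> {0..<n} \<and> card e = 2)"

definition degree_of :: "nat set set \<Rightarrow> nat \<Rightarrow> nat" where
  "degree_of E v = card {e \<in> E. v \<in> e}"

definition ISI_matrix :: "nat \<Rightarrow> nat set set \<Rightarrow> real mat" where
  "ISI_matrix n E = mat n n (\<lambda>(i, j).
     if {i, j} \<in> E
     then real (degree_of E i) * real (degree_of E j) / (real (degree_of E i) + real (degree_of E j))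
     else 0)"

text \<open>The eigenvalues are listed with their algebraic multiplicities, as the multiset of roots of
  the characteristic polynomial. Only real roots are counted; for the real symmetric matrices
  used here there are no others.\<close>

definition matrix_energy :: "real mat \<Rightarrow> real" where
  "matrix_energy A = (\<Sum>x\<in>#proots (char_poly A). \<bar>x\<bar>)"

definition ISI_energy :: "nat \<Rightarrow> nat set set \<Rightarrow> real" where
  "ISI_energy n E = matrix_energy (ISI_matrix n E)"

text \<open>The edge set of the complete \<open>t\<close>-partite graph on \<open>{0..<t * p}\<close> with all parts of size \<open>p\<close>:
  the parts are the blocks \<open>{k * p..<(k + 1) * p}\<close> for \<open>k < t\<close>, so \<open>i div p\<close> is the index of the
  part of the vertex \<open>i\<close>.\<close>

definition multipartite_edges :: "nat \<Rightarrow> nat \<Rightarrow> nat set set" where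
  "multipartite_edges t p = {{i, j} | i j. i < t * p \<and> j < t * p \<and> i div p \<noteq> j div p}"

lemma simple_graph_multipartite: "simple_graph (t * p) (multipartite_edges t p)"
  by (auto simp: simple_graph_def multipartite_edges_def card_2_iff)

lemma simple_graph_delete_edge: "simple_graph n E \<Longrightarrow> simple_graph n (E - {e})"
  by (auto simp: simple_graph_def)

lemma ISI_matrix_symmetric: "transpose_mat (ISI_matrix n E) = ISI_matrix n E"
  by (auto simp: ISI_matrix_def insert_commute mult.commute add.commute intro!: eq_matI)

end

theory Submission
  imports Defs
begin

text \<open>
  Write \<open>K\<close> for the complete \<open>t\<close>-partite graph with parts of size \<open>p\<close>, and put
  \<open>d = (t - 1) * p\<close>, \<open>a = d / 2\<close> and \<open>m = p - 1\<close>. Since \<open>K\<close> is \<open>d\<close>-regular, its matrix is \<open>a\<close>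
  times the adjacency matrix, whose eigenvalues are \<open>d\<close> (once), \<open>-p\<close> (\<open>t - 1\<close> times) and \<open>0\<close>;
  hence the energy of \<open>K\<close> is \<open>a * 2 * d = d\<^sup>2\<close>.

  Deleting \<open>e = {u, v}\<close> lowers two degrees to \<open>d - 1\<close>, which multiplies the entries in the rows and
  columns of \<open>u\<close> and \<open>v\<close> by \<open>\<beta> = (2 * d - 2) / (2 * d - 1)\<close>. With \<open>w = \<beta>\<close> at \<open>u, v\<close> and \<open>w = 1\<close>
  elsewhere, and with \<open>w\<^sub>k\<close> the restriction of \<open>w\<close> to the \<open>k\<close>-th part, the matrix of \<open>K - e\<close> is
  \<open>a * (w w\<^sup>T - (\<Sum>k. w\<^sub>k w\<^sub>k\<^sup>T) - B * (e\<^sub>u e\<^sub>v\<^sup>T + e\<^sub>v e\<^sub>u\<^sup>T))\<close> where \<open>B = \<beta>\<^sup>2\<close> and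
  \<open>e\<^sub>u, e\<^sub>v\<close> are unit vectors. The characteristic matrix is therefore a rank-three
  update of \<open>x I + a * (\<Sum>k. w\<^sub>k w\<^sub>k\<^sup>T)\<close>. As the \<open>w\<^sub>k\<close> have disjoint
  supports, both the determinant and the inverse of the latter are explicit, and Sylvester's identity
  \<open>det (I + X V) = det (I + V X)\<close> leaves a determinant of order three. The result is that, up to the
  factor \<open>a\<close>, the eigenvalues are \<open>0\<close> and \<open>-p\<close> with multiplicities, the roots of the quadratic
  \<open>x\<^sup>2 + m * x - B * m\<close> (eigenvectors antisymmetric under exchanging \<open>u\<close> with \<open>v\<close> and the rest of
  one part with the rest of the other), and the roots of a cubic \<open>g\<close> (symmetric eigenvectors).

  Only two eigenvalues are positive: the positive root \<open>\<nu>\<close> of the quadratic and the positive root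
  \<open>l\<close> of \<open>g\<close>. The trace vanishes, so the energy of \<open>K - e\<close> is twice the sum of the positive
  eigenvalues, that is \<open>d * (\<nu> + l)\<close>. It exceeds \<open>d\<^sup>2\<close> exactly if \<open>d - \<nu> < l\<close>, i.e. if
  \<open>g (d - \<nu>) < 0\<close>. Reducing \<open>g (d - \<nu>)\<close> modulo the quadratic makes it linear in \<open>\<nu>\<close>, and the
  resulting inequality (lemma \<open>reflected_root_bound\<close>) follows from crude rational lower bounds on
  \<open>\<nu>\<close> as soon as \<open>d \<ge> 6\<close>. The only excluded case is \<open>d = 4\<close>, the octahedron; there \<open>\<nu>\<close> and \<open>l\<close>
  are enclosed in rational intervals by sign changes.
\<close>

section \<open>Determinants of matrices with a low-rank part\<close>

text \<open>Sylvester's identity. Both sides are the determinant of a product of the same two block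
  matrices, one unipotent, taken in the two possible orders.\<close>

lemma det_one_plus_mult_commute:
  fixes X V :: "'a :: idom mat"
  assumes X: "X \<in> carrier_mat n k" and V: "V \<in> carrier_mat k n"
  shows "det (1\<^sub>m n + X * V) = det (1\<^sub>m k + V * X)"
proof -
  define P where "P = four_block_mat (1\<^sub>m n) X (0\<^sub>m k n) (1\<^sub>m k)"
  define Q where "Q = four_block_mat (1\<^sub>m n) (- X) V (1\<^sub>m k)"
  have P: "P \<in> carrier_mat (n + k) (n + k)" and Q: "Q \<in> carrier_mat (n + k) (n + k)"
    using X V by (auto simp: P_def Q_def)
  have zero: "X + - X = 0\<^sub>m n k" "- X + X = 0\<^sub>m n k"
    using X by (auto intro!: eq_matI)
  have "P * Q = four_block_mat (1\<^sub>m n + X * V) (0\<^sub>m n k) V (1\<^sub>m k)"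
    unfolding P_def Q_def using X V zero
    by (subst mult_four_block_mat[of _ n n _ k _ k _ _ n _ k]) auto
  moreover have "Q * P = four_block_mat (1\<^sub>m n) (0\<^sub>m n k) V (1\<^sub>m k + V * X)"
    unfolding P_def Q_def using X V zero
    by (subst mult_four_block_mat[of _ n n _ k _ k _ _ n _ k]) (auto simp: comm_add_mat)
  moreover have "det (P * Q) = det (Q * P)"
    using P Q by (simp add: det_mult mult.commute)
  ultimately show ?thesis
    using X V by (simp add: det_four_block_mat_upper_right_zero[of _ n _ k])
qed

lemma det_sylvester_entries:
  fixes X V :: "nat \<Rightarrow> nat \<Rightarrow> 'a :: idom"
  shows "det (mat n n (\<lambda>(i, j). of_bool (i = j) + (\<Sum>l<k. X i l * V l j))) =
    det (mat k k (\<lambda>(l, l'). of_bool (l = l') + (\<Sum>i<n. V l i * X i l')))"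
proof -
  let ?X = "mat n k (\<lambda>(i, l). X i l)" and ?V = "mat k n (\<lambda>(l, j). V l j)"
  have "mat n n (\<lambda>(i, j). of_bool (i = j) + (\<Sum>l<k. X i l * V l j)) = 1\<^sub>m n + ?X * ?V"
    by (auto intro!: eq_matI simp: scalar_prod_def lessThan_atLeast0)
  moreover have "mat k k (\<lambda>(l, l'). of_bool (l = l') + (\<Sum>i<n. V l i * X i l')) = 1\<^sub>m k + ?V * ?X"
    by (auto intro!: eq_matI simp: scalar_prod_def lessThan_atLeast0)
  ultimately show ?thesis
    using det_one_plus_mult_commute[of ?X n k ?V] by simp
qed

lemma det_diagonal_mat:
  fixes f :: "nat \<Rightarrow> 'a :: comm_ring_1"
  shows "det (mat k k (\<lambda>(l, l'). if l = l' then f l else 0)) = (\<Prod>l<k. f l)"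
proof -
  have "det (mat k k (\<lambda>(l, l'). if l = l' then f l else 0))
      = prod_list (diag_mat (mat k k (\<lambda>(l, l'). if l = l' then f l else 0)))"
    by (rule det_upper_triangular[of _ k]) (auto simp: upper_triangular_def)
  also have "\<dots> = (\<Prod>l<k. f l)"
    by (simp add: prod_list_diag_prod lessThan_atLeast0)
  finally show ?thesis .
qed

text \<open>The function \<open>c\<close> assigns a class to each of the indices below \<open>n\<close>. The value is the inner
  product of \<open>f\<close> with the vector \<open>w\<^sub>k\<close> obtained from \<open>w\<close> by restriction to the \<open>k\<close>-th class.\<close>

definition class_inner :: "nat \<Rightarrow> (nat \<Rightarrow> nat) \<Rightarrow> (nat \<Rightarrow> real) \<Rightarrow> (nat \<Rightarrow> real) \<Rightarrow> nat \<Rightarrow> real" where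
  "class_inner n c w f k = (\<Sum>i\<in>{i. i < n \<and> c i = k}. w i * f i)"

text \<open>This is \<open>x I + a * (\<Sum>k. w\<^sub>k w\<^sub>k\<^sup>T)\<close>: entries between different classes vanish, so it is block diagonal
  after sorting the indices by class.\<close>

definition class_matrix :: "nat \<Rightarrow> (nat \<Rightarrow> nat) \<Rightarrow> (nat \<Rightarrow> real) \<Rightarrow> real \<Rightarrow> real \<Rightarrow> real mat" where
  "class_matrix n c w a x =
    mat n n (\<lambda>(i, j). of_bool (i = j) * x + of_bool (c i = c j) * (a * w i * w j))"

text \<open>Sylvester's identity replaces the \<open>n\<close> indices by the \<open>t\<close> classes, and the Gram matrix of the
  vectors \<open>w\<^sub>k\<close> is diagonal because their supports are disjoint.\<close>

lemma det_class_matrix: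
  assumes c: "\<And>i. i < n \<Longrightarrow> c i < t" and x: "x \<noteq> 0"
  shows "det (class_matrix n c w a x) = x ^ n * (\<Prod>k<t. 1 + a * class_inner n c w w k / x)"
proof -
  let ?X = "\<lambda>i k. of_bool (c i = k) * (a * w i / x)" and ?V = "\<lambda>k i. of_bool (c i = k) * w i"
  let ?M = "mat n n (\<lambda>(i, j). of_bool (i = j) + (\<Sum>k<t. ?X i k * ?V k j))"
  have "class_matrix n c w a x = x \<cdot>\<^sub>m ?M"
  proof (rule eq_matI)
    fix i j assume "i < dim_row (x \<cdot>\<^sub>m ?M)" "j < dim_col (x \<cdot>\<^sub>m ?M)"
    then have ij: "i < n" "j < n"
      by simp_all
    have "(\<Sum>k<t. ?X i k * ?V k j)
      = (\<Sum>k<t. if k = c i then of_bool (c i = c j) * (a * w i * w j) / x else 0)"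
      by (intro sum.cong) auto
    also have "\<dots> = of_bool (c i = c j) * (a * w i * w j) / x"
      using c[OF ij(1)] by simp
    finally have sum: "(\<Sum>k<t. ?X i k * ?V k j) = of_bool (c i = c j) * (a * w i * w j) / x" .
    have "(x \<cdot>\<^sub>m ?M) $$ (i, j) = x * (of_bool (i = j) + (\<Sum>k<t. ?X i k * ?V k j))"
      using ij by simp
    also have "\<dots> = of_bool (i = j) * x + of_bool (c i = c j) * (a * w i * w j)"
      unfolding sum using x by (simp add: field_simps)
    finally show "class_matrix n c w a x $$ (i, j) = (x \<cdot>\<^sub>m ?M) $$ (i, j)"
      using ij by (simp add: class_matrix_def)
  qed (simp_all add: class_matrix_def)
  then have "det (class_matrix n c w a x)
      = x ^ n * det ?M"
    by (simp add: det_smult)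
  also have "\<dots> = x ^ n * det (mat t t (\<lambda>(k, k'). of_bool (k = k') + (\<Sum>i<n. ?V k i * ?X i k')))"
    unfolding det_sylvester_entries ..
  also have "mat t t (\<lambda>(k, k'). of_bool (k = k') + (\<Sum>i<n. ?V k i * ?X i k'))
      = mat t t (\<lambda>(k, k'). if k = k' then 1 + a * class_inner n c w w k / x else 0)"
  proof -
    have "(\<Sum>i<n. ?V k i * ?X i k) = (\<Sum>i | i < n \<and> c i = k. a / x * (w i * w i))" for k
      by (intro sum.mono_neutral_cong_right) auto
    then have "(\<Sum>i<n. ?V k i * ?X i k) = a * class_inner n c w w k / x" for k
      by (simp add: class_inner_def sum_distrib_left sum_divide_distrib)
    moreover have "(\<Sum>i<n. ?V k i * ?X i k') = 0" if "k \<noteq> k'" for k k'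
      using that by (intro sum.neutral) auto
    ultimately show ?thesis
      by (intro cong_mat refl) (simp only: split_conv, simp)
  qed
  finally show ?thesis
    by (simp add: det_diagonal_mat)
qed

text \<open>The solution \<open>y\<close> of the linear system with matrix \<open>class_matrix n c w a x\<close> and right-hand side
  \<open>f\<close>, given by the Sherman-Morrison formula within each class.\<close>

definition class_solve ::
  "nat \<Rightarrow> (nat \<Rightarrow> nat) \<Rightarrow> (nat \<Rightarrow> real) \<Rightarrow> real \<Rightarrow> real \<Rightarrow> (nat \<Rightarrow> real) \<Rightarrow> nat \<Rightarrow> real" where
  "class_solve n c w a x f i =
    (f i - a * w i * class_inner n c w f (c i) / (x + a * class_inner n c w w (c i))) / x"

text \<open>Pairing the system with \<open>w\<^sub>k\<close> gives a scalar equation in each class.\<close>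

lemma class_inner_class_solve:
  assumes x: "x \<noteq> 0" and S: "x + a * class_inner n c w w k \<noteq> 0"
  shows "class_inner n c w (class_solve n c w a x f) k
    = class_inner n c w f k / (x + a * class_inner n c w w k)"
proof -
  let ?F = "class_inner n c w f k" and ?S = "class_inner n c w w k"
  have eq: "F / x - a * F / Z / x * T = F / Z" if "Z \<noteq> 0" "Z = x + a * T" for F T Z
  proof -
    have "F / x - a * F / Z / x * T = F * (Z - a * T) / (x * Z)"
      using x that(1) by (simp add: field_simps)
    then show ?thesis
      using x that by simp
  qed
  have "class_inner n c w (class_solve n c w a x f) k
      = (\<Sum>j | j < n \<and> c j = k. (w j * f j) / x - a * ?F / (x + a * ?S) / x * (w j * w j))"
    unfolding class_inner_def[of n c w "class_solve n c w a x f"]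
    by (intro sum.cong) (auto simp: class_solve_def diff_divide_distrib right_diff_distrib mult_ac)
  also have "\<dots> = ?F / x - a * ?F / (x + a * ?S) / x * ?S"
    by (simp add: sum_subtractf class_inner_def sum_divide_distrib sum_distrib_left)
  finally show ?thesis
    using eq[OF S refl] by simp
qed

lemma class_solve_correct:
  assumes i: "i < n" and x: "x \<noteq> 0" and S: "x + a * class_inner n c w w (c i) \<noteq> 0"
  shows "(\<Sum>j<n. (of_bool (i = j) * x + of_bool (c i = c j) * (a * w i * w j)) * class_solve n c w a x f j) = f i"
proof -
  let ?y = "class_solve n c w a x f" and ?F = "class_inner n c w f (c i)" and ?S = "class_inner n c w w (c i)"
  have wy: "(\<Sum>j | j < n \<and> c j = c i. w j * ?y j) = ?F / (x + a * ?S)"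
    using class_inner_class_solve[OF x S, of f] by (simp add: class_inner_def)
  have "(\<Sum>j<n. (of_bool (i = j) * x + of_bool (c i = c j) * (a * w i * w j)) * ?y j)
      = (\<Sum>j<n. if j = i then x * ?y i else 0) + (\<Sum>j<n. of_bool (c j = c i) * (a * w i * (w j * ?y j)))"
    unfolding sum.distrib[symmetric] by (intro sum.cong) (auto simp: algebra_simps)
  also have "(\<Sum>j<n. of_bool (c j = c i) * (a * w i * (w j * ?y j)))
      = (\<Sum>j | j < n \<and> c j = c i. a * w i * (w j * ?y j))"
    by (intro sum.mono_neutral_cong_right) auto
  also have "\<dots> = a * w i * (?F / (x + a * ?S))"
    by (simp only: sum_distrib_left[symmetric] wy)
  finally show ?thesis
    using i x by (simp add: class_solve_def)
qed

text \<open>The matrix determinant lemma: if \<open>N Y = F\<close> then \<open>N + F V = N (I + Y V)\<close>, and Sylvester's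
  identity turns the second factor into a determinant of order \<open>r\<close>. The columns of \<open>F\<close> and the
  rows of \<open>V\<close> are the vectors \<open>f l\<close> and \<open>v l\<close>.\<close>

lemma det_class_matrix_update:
  assumes x: "x \<noteq> 0" and S: "\<And>i. i < n \<Longrightarrow> x + a * class_inner n c w w (c i) \<noteq> 0"
  shows "det (mat n n (\<lambda>(i, j). of_bool (i = j) * x + of_bool (c i = c j) * (a * w i * w j)
      + (\<Sum>l<r. f l i * v l j)))
    = det (class_matrix n c w a x)
      * det (mat r r (\<lambda>(l, l'). of_bool (l = l') + (\<Sum>i<n. v l i * class_solve n c w a x (f l') i)))"
proof -
  let ?N = "class_matrix n c w a x"
  let ?y = "\<lambda>l. class_solve n c w a x (f l)"
  let ?Q = "mat n n (\<lambda>(i, j). of_bool (i = j) + (\<Sum>l<r. ?y l i * v l j))"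
  have "mat n n (\<lambda>(i, j). of_bool (i = j) * x + of_bool (c i = c j) * (a * w i * w j)
      + (\<Sum>l<r. f l i * v l j)) = ?N * ?Q"
    (is "?L = _")
  proof (rule eq_matI)
    fix i j assume "i < dim_row (?N * ?Q)" "j < dim_col (?N * ?Q)"
    then have ij: "i < n" "j < n"
      by (simp_all add: class_matrix_def)
    let ?e = "\<lambda>i j. of_bool (i = j) * x + of_bool (c i = c j) * (a * w i * w j)"
    have "(?N * ?Q) $$ (i, j)
        = (\<Sum>h<n. ?e i h * (of_bool (h = j) + (\<Sum>l<r. ?y l h * v l j)))"
      using ij by (simp add: class_matrix_def scalar_prod_def lessThan_atLeast0)
    also have "\<dots> = (\<Sum>h<n. if h = j then ?e i j else 0) + (\<Sum>h<n. \<Sum>l<r. ?e i h * ?y l h * v l j)"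
      unfolding sum.distrib[symmetric]
      by (intro sum.cong) (auto simp: distrib_left sum_distrib_left mult.assoc)
    also have "(\<Sum>h<n. \<Sum>l<r. ?e i h * ?y l h * v l j) = (\<Sum>l<r. (\<Sum>h<n. ?e i h * ?y l h) * v l j)"
      by (subst sum.swap) (simp add: sum_distrib_right)
    also have "\<dots> = (\<Sum>l<r. f l i * v l j)"
      using class_solve_correct[OF ij(1) x S[OF ij(1)]] by simp
    finally show "?L $$ (i, j) = (?N * ?Q) $$ (i, j)"
      using ij by simp
  qed (simp_all add: class_matrix_def)
  then have "det (mat n n (\<lambda>(i, j). of_bool (i = j) * x + of_bool (c i = c j) * (a * w i * w j)
      + (\<Sum>l<r. f l i * v l j))) = det ?N * det ?Q"
    by (simp add: det_mult[of _ n] class_matrix_def)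
  then show ?thesis
    by (simp add: det_sylvester_entries)
qed

lemma sum_weight_eq_sum_class_inner:
  assumes "\<And>i. i < n \<Longrightarrow> c i < t"
  shows "(\<Sum>i<n. w i * f i) = (\<Sum>k<t. class_inner n c w f k)"
proof -
  have "(\<Sum>k<t. \<Sum>i | i \<in> {..<n} \<and> c i = k. w i * f i) = (\<Sum>i<n. w i * f i)"
    using assms by (intro sum.group) auto
  then show ?thesis
    by (simp add: class_inner_def)
qed

lemma det_1x1: "det (mat 1 1 (\<lambda>(i, j). M i j)) = M 0 0"
  by (subst det_single) auto

lemma det_2x2:
  fixes M :: "nat \<Rightarrow> nat \<Rightarrow> real"
  shows "det (mat 2 2 (\<lambda>(i, j). M i j)) = M 0 0 * M 1 1 - M 0 1 * M 1 0"
  by (subst laplace_expansion_row[of _ 2 0])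
    (auto simp: cofactor_def mat_delete_def numeral_2_eq_2 det_single)

lemma det_3x3:
  fixes M :: "nat \<Rightarrow> nat \<Rightarrow> real"
  shows "det (mat 3 3 (\<lambda>(i, j). M i j)) =
    M 0 0 * (M 1 1 * M 2 2 - M 1 2 * M 2 1) - M 0 1 * (M 1 0 * M 2 2 - M 1 2 * M 2 0)
    + M 0 2 * (M 1 0 * M 2 1 - M 1 1 * M 2 0)"
proof -
  have del: "mat_delete (mat 3 3 (\<lambda>(i, j). M i j)) 0 k
      = mat 2 2 (\<lambda>(i, j). M (Suc i) (if j < k then j else Suc j))" for k
    by (auto simp: mat_delete_def)
  have sum3: "(\<Sum>j<3. f j) = f 0 + f 1 + f 2" for f :: "nat \<Rightarrow> real"
    by (simp add: eval_nat_numeral)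
  have "det (mat 3 3 (\<lambda>(i, j). M i j)) = (\<Sum>j<3. M 0 j * cofactor (mat 3 3 (\<lambda>(i, j). M i j)) 0 j)"
    by (subst laplace_expansion_row[of _ 3 0]) auto
  then show ?thesis
    unfolding sum3 cofactor_def del det_2x2 by (simp add: algebra_simps eval_nat_numeral)
qed

section \<open>Energy from the values of the characteristic polynomial\<close>

lemma poly_char_poly_eq_det:
  fixes M :: "nat \<Rightarrow> nat \<Rightarrow> real"
  shows "poly (char_poly (mat n n (\<lambda>(i, j). M i j))) x
    = det (mat n n (\<lambda>(i, j). of_bool (i = j) * x - M i j))"
proof -
  have "- char_matrix (mat n n (\<lambda>(i, j). M i j)) x = mat n n (\<lambda>(i, j). of_bool (i = j) * x - M i j)"
    by (rule eq_matI) (auto simp: char_matrix_def)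
  then show ?thesis
    by (subst char_poly_matrix[of _ n]) auto
qed

text \<open>Two polynomials that agree at all positive points are equal, so the characteristic polynomial
  needs to be known there only; this keeps the resolvents in the determinant computation free of
  division by zero. The scale \<open>a\<close> is separated because the eigenvalues of the matrices below are
  \<open>d / 2\<close> times simpler numbers.\<close>

lemma matrix_energy_eq_sum_roots:
  fixes A :: "real mat" and a :: real
  assumes a: "a > 0"
    and poly: "\<And>s. s > 0 \<Longrightarrow> poly (char_poly A) (a * s) = a ^ size L * (\<Prod>l\<in>#L. s - l)"
  shows "matrix_energy A = a * (\<Sum>l\<in>#L. \<bar>l\<bar>)"
proof -
  define q where "q = (\<Prod>l\<in>#L. [:- (a * l), 1:])"
  have prod: "a ^ size K * (\<Prod>l\<in>#K. s - l) = poly (\<Prod>l\<in>#K. [:- (a * l), 1:]) (a * s)" for s K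
    by (induction K) (auto simp: algebra_simps)
  have eq: "poly (char_poly A) x = poly q x" if "x > 0" for x
    using poly[of "x / a"] prod[of L "x / a"] a that by (simp add: q_def)
  have "char_poly A = q"
  proof (rule ccontr)
    assume "char_poly A \<noteq> q"
    then have "finite {x. poly (char_poly A - q) x = 0}"
      by (intro poly_roots_finite) simp
    moreover have "{0<..} \<subseteq> {x. poly (char_poly A - q) x = 0}"
      using eq by auto
    ultimately show False
      using infinite_Ioi[of "0::real"] finite_subset by blast
  qed
  moreover have "proots (\<Prod>l\<in>#K. [:- (a * l), 1:]) = image_mset (\<lambda>l. a * l) K" for K
  proof (induction K)
    case (add l K)
    have "(\<Prod>l\<in>#K. [:- (a * l), 1:]) \<noteq> 0"
      by (auto simp: prod_mset_zero_iff)
    then have "proots ([:- (a * l), 1:] * (\<Prod>l\<in>#K. [:- (a * l), 1:]))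
        = {#a * l#} + proots (\<Prod>l\<in>#K. [:- (a * l), 1:])"
      by (subst proots_mult) (auto simp del: mult_pCons_left)
    then show ?case
      using add.IH by (simp del: mult_pCons_left)
  qed simp
  ultimately have "proots (char_poly A) = image_mset (\<lambda>l. a * l) L"
    by (simp add: q_def)
  then show ?thesis
    using a by (simp add: matrix_energy_def image_mset.compositionality comp_def abs_mult sum_mset_distrib_left)
qed

section \<open>The complete multipartite graph\<close>

lemma card_part:
  assumes "k < t"
  shows "card {i. i < t * p \<and> i div p = k} = p"
proof (cases "p = 0")
  case False
  have iff: "i div p = k \<longleftrightarrow> k * p \<le> i \<and> i < k * p + p" for i
    using False dividend_less_div_times[of p i]
    by (auto simp: mult.commute intro!: div_nat_eqI)
  have "k * p + p \<le> t * p"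
    using assms mult_le_mono1[of "Suc k" t p] by simp
  then have "{i. i < t * p \<and> i div p = k} = {k * p..<k * p + p}"
    by (auto simp: iff)
  then show ?thesis
    by simp
qed auto

lemma finite_multipartite_edges: "finite (multipartite_edges t p)"
  by (rule finite_subset[of _ "Pow {..<t * p}"]) (auto simp: multipartite_edges_def)

lemma mem_multipartite_edges_iff:
  "{i, j} \<in> multipartite_edges t p \<longleftrightarrow> i < t * p \<and> j < t * p \<and> i div p \<noteq> j div p"
  by (auto simp: multipartite_edges_def doubleton_eq_iff)

lemma degree_multipartite:
  assumes i: "i < t * p"
  shows "degree_of (multipartite_edges t p) i = (t - 1) * p"
proof -
  have p: "p > 0"
    using i by (cases p) auto
  have k: "i div p < t"
    using i p by (simp add: div_less_iff_less_mult)
  have "{e \<in> multipartite_edges t p. i \<in> e}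
      = (\<lambda>j. {i, j}) ` ({..<t * p} - {j. j < t * p \<and> j div p = i div p})"
    using i by (auto simp: multipartite_edges_def)
  moreover have "inj_on (\<lambda>j. {i, j}) ({..<t * p} - {j. j < t * p \<and> j div p = i div p})"
    using i by (auto simp: inj_on_def doubleton_eq_iff)
  ultimately have "degree_of (multipartite_edges t p) i
      = card ({..<t * p} - {j. j < t * p \<and> j div p = i div p})"
    by (simp add: degree_of_def card_image)
  also have "\<dots> = t * p - card {j. j < t * p \<and> j div p = i div p}"
    by (subst card_Diff_subset) auto
  also have "\<dots> = (t - 1) * p"
    by (simp add: card_part[OF k] diff_mult_distrib)
  finally show ?thesis .
qed

lemma ISI_matrix_multipartite:
  "ISI_matrix (t * p) (multipartite_edges t p)
    = mat (t * p) (t * p) (\<lambda>(i, j). of_bool (i div p \<noteq> j div p) * (real ((t - 1) * p) / 2))"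
  unfolding ISI_matrix_def
  by (rule cong_mat) (auto simp: mem_multipartite_edges_iff degree_multipartite)

text \<open>The matrix is the update of \<open>x I + a * (\<Sum>k. w\<^sub>k w\<^sub>k\<^sup>T)\<close>, for the constant weight \<open>w = 1\<close>, by the
  single rank-one matrix \<open>- a * w w\<^sup>T\<close>. The eigenvalues are \<open>a * d\<close>, \<open>- a * p\<close> with multiplicity
  \<open>t - 1\<close>, and \<open>0\<close>.\<close>

lemma ISI_energy_multipartite:
  assumes t: "t \<ge> 2" and p: "p > 0"
  shows "ISI_energy (t * p) (multipartite_edges t p) = (real ((t - 1) * p))\<^sup>2"
proof -
  let ?n = "t * p" and ?c = "\<lambda>i. i div p" and ?w = "\<lambda>_::nat. 1::real"
  define d where "d = real ((t - 1) * p)"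
  define a where "a = d / 2"
  let ?L = "add_mset d (replicate_mset (t - 1) (- real p) + replicate_mset (t * p - t) 0)"
  have a: "a > 0"
    using t p by (simp add: a_def d_def)
  have c: "?c i < t" if "i < ?n" for i
    using that p by (simp add: div_less_iff_less_mult)
  have form: "class_inner ?n ?c ?w ?w k = p" if "k < t" for k
    using card_part[OF that, of p] by (simp add: class_inner_def)
  have "poly (char_poly (ISI_matrix ?n (multipartite_edges t p))) (a * s)
      = a ^ size ?L * (\<Prod>l\<in>#?L. s - l)" if s: "s > 0" for s
  proof -
    have x: "a * s \<noteq> 0" and xp: "a * s + a * p \<noteq> 0" and sp: "s + p \<noteq> 0"
      using a s p by (auto simp: add_nonneg_eq_0_iff)
    let ?y = "class_solve ?n ?c ?w a (a * s)"
    have "poly (char_poly (ISI_matrix ?n (multipartite_edges t p))) (a * s)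
        = det (mat ?n ?n (\<lambda>(i, j). of_bool (i = j) * (a * s) + of_bool (?c i = ?c j) * (a * ?w i * ?w j)
            + (\<Sum>l<Suc 0. (\<lambda>_. ?w) l i * (\<lambda>_ _. - a) l j)))"
      unfolding ISI_matrix_multipartite poly_char_poly_eq_det
      by (intro arg_cong[of _ _ det] cong_mat) (auto simp: a_def d_def)
    also have "\<dots> = det (class_matrix ?n ?c ?w a (a * s)) * (1 - a * (\<Sum>i<?n. ?w i * ?y ?w i))"
      by (subst det_class_matrix_update)
        (use x xp c form in \<open>auto simp: det_1x1[unfolded One_nat_def] sum_distrib_left sum_negf\<close>)
    also have "(\<Sum>i<?n. ?w i * ?y ?w i) = (\<Sum>k<t. class_inner ?n ?c ?w (?y ?w) k)"
      by (rule sum_weight_eq_sum_class_inner) (rule c)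
    also have "\<dots> = (\<Sum>k<t. p / (a * s + a * p))"
      using x xp form by (intro sum.cong refl) (simp add: class_inner_class_solve)
    also have "det (class_matrix ?n ?c ?w a (a * s)) = (a * s) ^ ?n * (\<Prod>k<t. 1 + a * p / (a * s))"
      using det_class_matrix[of ?n ?c t "a * s" ?w a] c x form by simp
    also have "1 - a * (\<Sum>k<t. p / (a * s + a * p)) = (s - d) / (s + p)"
    proof -
      have "a * (\<Sum>k<t. p / (a * s + a * p)) = a * (t * p) / (a * (s + p))"
        by (simp add: distrib_left)
      also have "\<dots> = t * p / (s + p)"
        using a by (subst mult_divide_mult_cancel_left) auto
      finally show ?thesis
        using sp t by (simp add: d_def of_nat_diff left_diff_distrib field_simps)
    qed
    also have "(\<Prod>k<t. 1 + a * p / (a * s)) = ((s + p) / s) ^ t"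
      using a s by (simp add: field_simps)
    also have "(a * s) ^ ?n * ((s + p) / s) ^ t * ((s - d) / (s + p))
        = a ^ ?n * ((s - d) * (s + p) ^ (t - 1) * s ^ (?n - t))"
    proof -
      have "s ^ ?n = s ^ (?n - t) * s ^ t"
        using p by (simp flip: power_add)
      moreover have "(s + p) ^ t = (s + p) ^ (t - 1) * (s + p)"
        using t by (simp flip: power_Suc2)
      ultimately show ?thesis
        using s sp by (simp add: power_mult_distrib power_divide)
    qed
    also have "\<dots> = a ^ size ?L * (\<Prod>l\<in>#?L. s - l)"
    proof -
      have "t \<le> t * p"
        using p by simp
      then have "size ?L = ?n"
        using t by simp
      then show ?thesis
        unfolding \<open>size ?L = ?n\<close> by (simp add: mult.assoc)
    qed
    finally show ?thesis .
  qed
  then have "ISI_energy ?n (multipartite_edges t p) = a * (\<Sum>l\<in>#?L. \<bar>l\<bar>)"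
    unfolding ISI_energy_def by (intro matrix_energy_eq_sum_roots a)
  also have "(\<Sum>l\<in>#?L. \<bar>l\<bar>) = 2 * d"
    using t by (simp add: d_def)
  finally show ?thesis
    by (simp add: a_def d_def power2_eq_square)
qed

section \<open>Characteristic polynomial after deletion of an edge\<close>

lemma degree_delete_edge:
  assumes "finite E" "e \<in> E"
  shows "degree_of (E - {e}) i = (if i \<in> e then degree_of E i - 1 else degree_of E i)"
proof -
  have "{f \<in> E - {e}. i \<in> f} = {f \<in> E. i \<in> f} - {e}"
    by auto
  then show ?thesis
    using assms by (auto simp: degree_of_def)
qed

text \<open>An entry with both end points of full degree is \<open>d / 2\<close>; with one end point in the deleted edge
  it is \<open>d * (d - 1) / (2 * d - 1)\<close>, which is \<open>d / 2\<close> times the weight. Two end points of the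
  deleted edge are no longer adjacent, so the entry is \<open>d / 2 * w i * w j\<close> wherever it is nonzero.\<close>

lemma ISI_matrix_multipartite_delete:
  fixes t p u v :: nat
  defines "d \<equiv> real ((t - 1) * p)"
  defines "w \<equiv> \<lambda>i. if i = u \<or> i = v then (2 * d - 2) / (2 * d - 1) else 1"
  assumes uv: "u < t * p" "v < t * p" "u div p \<noteq> v div p"
  shows "ISI_matrix (t * p) (multipartite_edges t p - {{u, v}})
    = mat (t * p) (t * p) (\<lambda>(i, j).
        of_bool (i div p \<noteq> j div p \<and> {i, j} \<noteq> {u, v}) * (d / 2 * w i * w j))"
proof -
  have "t \<noteq> 0"
    using uv by (cases "t = 0") simp_all
  moreover have "p \<noteq> 0"
    using uv by (cases "p = 0") simp_all
  moreover have "t \<noteq> 1"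
    using uv by auto
  ultimately have "(t - 1) * p \<ge> 1"
    by (cases t) (auto simp: Suc_le_eq)
  then have d: "d \<ge> 1" and d1: "real ((t - 1) * p - 1) = d - 1"
    by (auto simp: d_def of_nat_diff simp del: of_nat_mult)
  have deg: "real (degree_of (multipartite_edges t p - {{u, v}}) i) = (if i = u \<or> i = v then d - 1 else d)"
    if "i < t * p" for i
    using that uv d1
    by (simp add: degree_delete_edge finite_multipartite_edges mem_multipartite_edges_iff
        degree_multipartite d_def del: of_nat_mult of_nat_diff)
  show ?thesis
    unfolding ISI_matrix_def
  proof (rule cong_mat; clarify)
    fix i j assume ij: "i < t * p" "j < t * p"
    let ?D = "\<lambda>i. if i = u \<or> i = v then d - 1 else d"
    let ?E = "multipartite_edges t p - {{u, v}}"
    have edge: "{i, j} \<in> ?E \<longleftrightarrow> i div p \<noteq> j div p \<and> {i, j} \<noteq> {u, v}"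
      using ij by (simp add: mem_multipartite_edges_iff)
    have entry: "?D i * ?D j / (?D i + ?D j) = d / 2 * w i * w j"
      if "i div p \<noteq> j div p \<and> {i, j} \<noteq> {u, v}"
    proof -
      have "2 * d - 1 > 0"
        using d by simp
      have "\<not> ((i = u \<or> i = v) \<and> (j = u \<or> j = v))"
        using that by (auto simp: insert_commute)
      then consider "i = u \<or> i = v" "j \<noteq> u" "j \<noteq> v" | "j = u \<or> j = v" "i \<noteq> u" "i \<noteq> v"
        | "i \<noteq> u" "i \<noteq> v" "j \<noteq> u" "j \<noteq> v"
        by blast
      then show ?thesis
      proof cases
        case 1
        then have "?D i = d - 1" "?D j = d" "w i = (2 * d - 2) / (2 * d - 1)" "w j = 1"
          by (simp_all add: w_def)
        then show ?thesis
          using \<open>2 * d - 1 > 0\<close> by (simp only:) (simp add: field_simps)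
      next
        case 2
        then have "?D j = d - 1" "?D i = d" "w j = (2 * d - 2) / (2 * d - 1)" "w i = 1"
          by (simp_all add: w_def)
        then show ?thesis
          using \<open>2 * d - 1 > 0\<close> by (simp only:) (simp add: field_simps)
      next
        case 3
        then show ?thesis
          using d by (simp add: w_def)
      qed
    qed
    show "(if {i, j} \<in> ?E
        then real (degree_of ?E i) * real (degree_of ?E j) / (real (degree_of ?E i) + real (degree_of ?E j))
        else 0)
      = of_bool (i div p \<noteq> j div p \<and> {i, j} \<noteq> {u, v}) * (d / 2 * w i * w j)"
      unfolding edge deg[OF ij(1)] deg[OF ij(2)] using entry by simp
  qed
qed

lemma sum_two_special:
  fixes A C :: real
  assumes "k < t" "l < t" "k \<noteq> (l::nat)"
  shows "(\<Sum>h<t. if h = k \<or> h = l then A else C) = 2 * A + (real t - 2) * C"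
proof -
  have split: "{..<t} = insert k (insert l ({..<t} - {k, l}))"
    using assms by auto
  have "(\<Sum>h\<in>{..<t} - {k, l}. if h = k \<or> h = l then A else C) = (\<Sum>h\<in>{..<t} - {k, l}. C)"
    by (intro sum.cong) auto
  also have "\<dots> = (real t - 2) * C"
    using assms by (simp add: card_Diff_subset of_nat_diff)
  finally show ?thesis
    using assms(3) by (subst split) simp
qed

lemma prod_two_special:
  fixes A C :: real
  assumes "k < t" "l < t" "k \<noteq> (l::nat)"
  shows "(\<Prod>h<t. if h = k \<or> h = l then A else C) = A\<^sup>2 * C ^ (t - 2)"
proof -
  have split: "{..<t} = insert k (insert l ({..<t} - {k, l}))"
    using assms by auto
  have "(\<Prod>h\<in>{..<t} - {k, l}. if h = k \<or> h = l then A else C) = (\<Prod>h\<in>{..<t} - {k, l}. C)"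
    by (intro prod.cong) auto
  also have "\<dots> = C ^ (t - 2)"
    using assms by (simp add: card_Diff_subset numeral_2_eq_2)
  finally show ?thesis
    using assms(3) by (subst split) (simp add: power2_eq_square)
qed

text \<open>The left-hand side is the determinant of the matrix with rows \<open>(P, - a h, - a h)\<close>,
  \<open>(k, 1, k3)\<close> and \<open>(k, k3, 1)\<close>. Its symmetry under exchanging the last two indices makes it the
  product of the antisymmetric part \<open>1 - k3\<close>, which gives the quadratic, and the symmetric part
  \<open>P * (1 + k3) + 2 * a * h * k\<close>, which gives the cubic. Here \<open>\<tau> = t - 2\<close> is the number of parts
  that do not meet the deleted edge, and \<open>S = m + B\<close> is the squared norm of \<open>w\<close> on each of the
  other two.\<close>

lemma update_determinant_factors:
  fixes a s m B \<beta> p \<tau> d S h G W P k k3 :: real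
  assumes pos: "a > 0" "s > 0" "m > 0" "B > 0"
    and B: "B = \<beta>\<^sup>2" and p: "p = m + 1" and d: "d = (\<tau> + 1) * p" and S: "S = m + B"
    and h: "h = \<beta> / (a * s + a * S)" and G: "G = (1 - a * B / (a * s + a * S)) / (a * s)"
    and W: "W = 2 * (S / (a * s + a * S)) + \<tau> * (p / (a * s + a * p))"
    and P: "P = 1 - a * W" and k: "k = a * B * h" and k3: "k3 = a * B * G"
  shows "P * (1 * 1 - k3 * k3) - (- (a * h)) * (k * 1 - k3 * k) + (- (a * h)) * (k * k3 - 1 * k)
    = (s\<^sup>2 + m * s - B * m)
      * (s ^ 3 - (d - m - 2) * s\<^sup>2 - (B * (2 * d - m - 2) + m * d) * s - B * m * d)
      / (s\<^sup>2 * (s + S)\<^sup>2 * (s + p))"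
proof -
  define Z where "Z = s + S"
  define Y where "Y = s + p"
  have nz: "s \<noteq> 0" "Z \<noteq> 0" "Y \<noteq> 0" "a \<noteq> 0"
    using pos by (auto simp: Z_def Y_def S p)
  have aZ: "a * s + a * S = a * Z" and aY: "a * s + a * p = a * Y"
    by (simp_all add: Z_def Y_def distrib_left)
  have ah: "a * h = \<beta> / Z"
    using nz by (simp add: h aZ)
  have ahk: "a * h * k = B\<^sup>2 / Z\<^sup>2"
    unfolding k h aZ B using nz by (simp add: power2_eq_square)
  have k3: "k3 = B * (s + m) / (s * Z)"
  proof -
    have "k3 = B * (Z - B) / (s * Z)"
      unfolding k3 G aZ using nz by (simp add: field_simps)
    then show ?thesis
      by (simp add: Z_def S)
  qed
  have P: "P = (Y * (s - S) - \<tau> * p * Z) / (Z * Y)"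
  proof -
    have "P = 1 - 2 * S / Z - \<tau> * p / Y"
      unfolding P W aZ aY using nz by (simp add: field_simps)
    also have "\<dots> = (Y * (Z - 2 * S) - \<tau> * p * Z) / (Z * Y)"
      using nz by (simp add: field_simps)
    finally show ?thesis
      by (simp add: Z_def)
  qed
  have "P * (1 * 1 - k3 * k3) - (- (a * h)) * (k * 1 - k3 * k) + (- (a * h)) * (k * k3 - 1 * k)
      = (1 - k3) * (P * (1 + k3) + 2 * (a * h * k))"
    by (simp add: algebra_simps)
  also have "1 - k3 = (s\<^sup>2 + m * s - B * m) / (s * Z)"
  proof -
    have "1 - k3 = (s * Z - B * (s + m)) / (s * Z)"
      unfolding k3 using nz by (simp add: field_simps)
    then show ?thesis
      by (simp add: Z_def S power2_eq_square algebra_simps)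
  qed
  also have "P * (1 + k3) + 2 * (a * h * k)
      = (s ^ 3 - (d - m - 2) * s\<^sup>2 - (B * (2 * d - m - 2) + m * d) * s - B * m * d) / (s * Z * Y)"
    (is "_ = ?g / _")
  proof -
    have "P * (1 + k3) + 2 * (a * h * k)
        = ((Y * (s - S) - \<tau> * p * Z) * (s * Z + B * (s + m)) + 2 * B\<^sup>2 * s * Y) / (s * Z\<^sup>2 * Y)"
      unfolding P k3 ahk using nz by (simp add: field_simps power2_eq_square)
    also have "(Y * (s - S) - \<tau> * p * Z) * (s * Z + B * (s + m)) + 2 * B\<^sup>2 * s * Y = ?g * Z"
      unfolding Z_def Y_def S p d
      by (simp add: power2_eq_square power3_eq_cube algebra_simps)
    finally show ?thesis
      using nz by (simp add: power2_eq_square)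
  qed
  finally show ?thesis
    by (simp add: Z_def Y_def power2_eq_square mult_ac)
qed

text \<open>The characteristic matrix is \<open>x I + a * (\<Sum>k. w\<^sub>k w\<^sub>k\<^sup>T)\<close> plus the three rank-one matrices
  \<open>- a * w w\<^sup>T\<close>, \<open>a * B * e\<^sub>u e\<^sub>v\<^sup>T\<close> and \<open>a * B * e\<^sub>v e\<^sub>u\<^sup>T\<close>. The last two remove the entries at
  \<open>(u, v)\<close> and \<open>(v, u)\<close>, which the weights alone would leave at \<open>a * \<beta>\<^sup>2\<close>.\<close>

lemma poly_char_poly_multipartite_delete:
  fixes t p u v :: nat and s d m B :: real
  defines "d \<equiv> real ((t - 1) * p)" and "m \<equiv> real p - 1" and "B \<equiv> ((2 * d - 2) / (2 * d - 1))\<^sup>2"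
  assumes t: "t \<ge> 3" and p: "p \<ge> 2" and uv: "u < t * p" "v < t * p" "u div p \<noteq> v div p"
    and s: "s > 0"
  shows "poly (char_poly (ISI_matrix (t * p) (multipartite_edges t p - {{u, v}}))) (d / 2 * s)
    = (d / 2) ^ (t * p) * s ^ (t * p - t - 2) * (s + p) ^ (t - 3) * (s\<^sup>2 + m * s - B * m)
      * (s ^ 3 - (d - m - 2) * s\<^sup>2 - (B * (2 * d - m - 2) + m * d) * s - B * m * d)"
proof -
  let ?n = "t * p" and ?c = "\<lambda>i. i div p"
  define a where "a = d / 2"
  define \<beta> where "\<beta> = (2 * d - 2) / (2 * d - 1)"
  define w where "w = (\<lambda>i. if i = u \<or> i = v then \<beta> else 1)"
  define eu ev :: "nat \<Rightarrow> real" where "eu = (\<lambda>i. of_bool (i = u))" and "ev = (\<lambda>i. of_bool (i = v))"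
  define S where "S = m + B"
  let ?x = "a * s"
  let ?y = "class_solve ?n ?c w a ?x"
  let ?M = "ISI_matrix ?n (multipartite_edges t p - {{u, v}})"
  have neq: "u \<noteq> v"
    using uv by auto
  have "2 * 2 \<le> (t - 1) * p"
    using t p by (intro mult_mono) auto
  then have d: "d \<ge> 4"
    by (simp add: d_def del: of_nat_mult)
  have m: "m > 0" and B: "B > 0" "B = \<beta>\<^sup>2" and a: "a > 0"
    using p d by (auto simp: m_def B_def \<beta>_def a_def)
  have c: "?c i < t" if "i < ?n" for i
    using that p by (simp add: div_less_iff_less_mult)
  have form: "class_inner ?n ?c w w k = (if k = ?c u \<or> k = ?c v then S else p)" if "k < t" for k
  proof -
    have "class_inner ?n ?c w w k
        = (\<Sum>i | i < ?n \<and> ?c i = k. 1 - (if i = u then 1 - B else 0) - (if i = v then 1 - B else 0))"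
      unfolding class_inner_def using neq
      by (intro sum.cong refl) (auto simp: w_def B power2_eq_square)
    also have "\<dots> = p - of_bool (k = ?c u) * (1 - B) - of_bool (k = ?c v) * (1 - B)"
      using uv by (auto simp: sum_subtractf card_part[OF that] sum.delta)
    also have "\<dots> = (if k = ?c u \<or> k = ?c v then S else p)"
      using uv by (auto simp: S_def m_def)
    finally show ?thesis .
  qed
  have form_e: "class_inner ?n ?c w (\<lambda>i. of_bool (i = q)) k = of_bool (k = ?c q) * w q"
    if "q < ?n" for q k
  proof -
    have "class_inner ?n ?c w (\<lambda>i. of_bool (i = q)) k
        = (\<Sum>i | i < ?n \<and> ?c i = k. if i = q then w q else 0)"
      unfolding class_inner_def by (intro sum.cong) auto
    also have "\<dots> = of_bool (k = ?c q) * w q"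
      using that by (subst sum.delta) auto
    finally show ?thesis .
  qed
  have cuv: "?c u < t" "?c v < t"
    using uv c by auto
  have S: "S > 0"
    using m B(1) by (simp add: S_def)
  have x: "?x > 0"
    using a s by simp
  have nzS: "?x + a * S > 0" and nzp: "?x + a * p > 0"
    using x a S by (auto intro: add_pos_nonneg)
  have nz: "?x + a * class_inner ?n ?c w w k \<noteq> 0" if "k < t" for k
    using nzS nzp by (simp add: form[OF that])

  \<comment> \<open>The entries of the determinant of order three are inner products of \<open>w\<close>, \<open>eu\<close>, \<open>ev\<close> with
    the solutions of the systems for these three vectors.\<close>
  have sum_y: "(\<Sum>i<?n. w i * ?y f i)
      = (\<Sum>k<t. class_inner ?n ?c w f k / (?x + a * class_inner ?n ?c w w k))" for f
  proof -
    have "(\<Sum>i<?n. w i * ?y f i) = (\<Sum>k<t. class_inner ?n ?c w (?y f) k)"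
      by (rule sum_weight_eq_sum_class_inner) (rule c)
    also have "\<dots> = (\<Sum>k<t. class_inner ?n ?c w f k / (?x + a * class_inner ?n ?c w w k))"
      using x by (intro sum.cong refl class_inner_class_solve nz) auto
    finally show ?thesis .
  qed
  define h where "h = \<beta> / (?x + a * S)"
  define G where "G = (1 - a * B / (?x + a * S)) / ?x"
  define W where "W = 2 * (S / (?x + a * S)) + (real t - 2) * (p / (?x + a * p))"
  have ww: "(\<Sum>i<?n. w i * ?y w i) = W"
  proof -
    have "(\<Sum>i<?n. w i * ?y w i)
        = (\<Sum>k<t. if k = ?c u \<or> k = ?c v then S / (?x + a * S) else p / (?x + a * p))"
      unfolding sum_y by (intro sum.cong) (auto simp: form)
    also have "\<dots> = W"
      using cuv uv by (subst sum_two_special) (auto simp: W_def)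
    finally show ?thesis .
  qed
  have w_end: "w q = \<beta>" if "q = u \<or> q = v" for q
    using that by (auto simp: w_def)
  have we: "(\<Sum>i<?n. w i * ?y (\<lambda>i. of_bool (i = q)) i) = h" if q: "q = u \<or> q = v" for q
  proof -
    have "(\<Sum>i<?n. w i * ?y (\<lambda>i. of_bool (i = q)) i)
        = (\<Sum>k<t. if k = ?c q then \<beta> / (?x + a * S) else 0)"
      unfolding sum_y using q uv by (intro sum.cong) (auto simp: form form_e w_end)
    also have "\<dots> = h"
      using q cuv by (auto simp: h_def)
    finally show ?thesis .
  qed
  have yw: "?y w q = h" if q: "q = u \<or> q = v" for q
  proof -
    have "?y w q = (\<beta> - a * \<beta> * S / (?x + a * S)) / ?x"
      using q cuv by (auto simp: class_solve_def form w_end)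
    also have "\<beta> - a * \<beta> * S / (?x + a * S) = \<beta> * ?x / (?x + a * S)"
      using nzS by (simp add: field_simps)
    finally show ?thesis
      using a s by (simp add: h_def)
  qed
  have yee: "?y (\<lambda>i. of_bool (i = q)) q = G" if q: "q = u \<or> q = v" for q
    using q cuv uv by (auto simp: class_solve_def form form_e w_end G_def B power2_eq_square)
  have yuv: "?y (\<lambda>i. of_bool (i = u)) v = 0" "?y (\<lambda>i. of_bool (i = v)) u = 0"
    using neq uv by (auto simp: class_solve_def form_e)

  \<comment> \<open>The \<open>l\<close>-th rank-one matrix is the product of the column \<open>F l\<close> and the row \<open>V l\<close>.\<close>
  define F where "F = (!) [w, eu, ev]"
  define V where "V = (!) [\<lambda>i. - a * w i, \<lambda>i. a * B * ev i, \<lambda>i. a * B * eu i]"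
  have sum3: "(\<Sum>l<3. f l) = f 0 + f 1 + f 2" for f :: "nat \<Rightarrow> real"
    by (simp add: eval_nat_numeral)
  have "poly (char_poly ?M) ?x
      = det (mat ?n ?n (\<lambda>(i, j). of_bool (i = j) * ?x + of_bool (?c i = ?c j) * (a * w i * w j)
          + (\<Sum>l<3. F l i * V l j)))"
  proof -
    have M: "?M = mat ?n ?n (\<lambda>(i, j). of_bool (?c i \<noteq> ?c j \<and> {i, j} \<noteq> {u, v}) * (a * w i * w j))"
      unfolding w_def \<beta>_def a_def d_def by (rule ISI_matrix_multipartite_delete[OF uv])
    show ?thesis
      unfolding M poly_char_poly_eq_det
    proof (intro arg_cong[of _ _ det] cong_mat refl; simp only: split_conv)
      fix i j assume "i < ?n" "j < ?n"
      have "(\<Sum>l<3. F l i * V l j) = - (a * w i * w j) + a * B * (eu i * ev j + ev i * eu j)"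
        unfolding sum3 by (simp add: F_def V_def algebra_simps)
      moreover have "eu i * ev j + ev i * eu j = of_bool ({i, j} = {u, v})"
        using neq by (auto simp: eu_def ev_def doubleton_eq_iff)
      moreover have "a * w i * w j = a * B" "?c i \<noteq> ?c j" if "{i, j} = {u, v}"
        using that uv by (auto simp: w_def B power2_eq_square doubleton_eq_iff)
      ultimately show "of_bool (i = j) * ?x - of_bool (?c i \<noteq> ?c j \<and> {i, j} \<noteq> {u, v}) * (a * w i * w j)
          = of_bool (i = j) * ?x + of_bool (?c i = ?c j) * (a * w i * w j) + (\<Sum>l<3. F l i * V l j)"
        by (cases "{i, j} = {u, v}"; cases "?c i = ?c j") auto
    qed
  qed
  also have "\<dots> = det (class_matrix ?n ?c w a ?x)
      * det (mat 3 3 (\<lambda>(l, l'). of_bool (l = l') + (\<Sum>i<?n. V l i * ?y (F l') i)))"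
    using x nz c by (intro det_class_matrix_update) auto
  also have "det (mat 3 3 (\<lambda>(l, l'). of_bool (l = l') + (\<Sum>i<?n. V l i * ?y (F l') i)))
      = (1 - a * W) * (1 * 1 - (a * B * G) * (a * B * G))
        - (- (a * h)) * ((a * B * h) * 1 - (a * B * G) * (a * B * h))
        + (- (a * h)) * ((a * B * h) * (a * B * G) - 1 * (a * B * h))"
  proof -
    have V0: "(\<Sum>i<?n. V 0 i * f i) = - a * (\<Sum>i<?n. w i * f i)" for f
      by (simp add: V_def sum_distrib_left sum_negf mult.assoc)
    have delta: "(\<Sum>i<?n. a * B * of_bool (i = q) * f i) = a * B * f q" if "q < ?n" for f q
    proof -
      have "(\<Sum>i<?n. a * B * of_bool (i = q) * f i) = (\<Sum>i<?n. if i = q then a * B * f q else 0)"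
        by (intro sum.cong) auto
      then show ?thesis
        using that by simp
    qed
    have V1: "(\<Sum>i<?n. V 1 i * f i) = a * B * f v" and V2: "(\<Sum>i<?n. V 2 i * f i) = a * B * f u" for f
      using delta uv by (simp_all add: V_def eu_def ev_def)
    have F: "F 0 = w" "F 1 = (\<lambda>i. of_bool (i = u))" "F 2 = (\<lambda>i. of_bool (i = v))"
      by (simp_all add: F_def eu_def ev_def)
    show ?thesis
      unfolding det_3x3 V0 V1 V2 F by (simp add: ww we yw yee yuv)
  qed
  also have "\<dots> = (s\<^sup>2 + m * s - B * m)
      * (s ^ 3 - (d - m - 2) * s\<^sup>2 - (B * (2 * d - m - 2) + m * d) * s - B * m * d)
      / (s\<^sup>2 * (s + S)\<^sup>2 * (s + p))"
    by (rule update_determinant_factors[OF a s m B(1,2) _ _ S_def h_def G_def W_def refl refl refl])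
      (use t in \<open>auto simp: m_def d_def of_nat_diff\<close>)
  also have "det (class_matrix ?n ?c w a ?x) = ?x ^ ?n * (\<Prod>k<t. 1 + a * class_inner ?n ?c w w k / ?x)"
    using x c by (intro det_class_matrix) auto
  also have "(\<Prod>k<t. 1 + a * class_inner ?n ?c w w k / ?x)
      = (\<Prod>k<t. if k = ?c u \<or> k = ?c v then (s + S) / s else (s + p) / s)"
  proof (intro prod.cong refl)
    fix k assume "k \<in> {..<t}"
    moreover have "1 + a * c / ?x = (s + c) / s" for c
      using a s by (simp add: field_simps)
    ultimately show "1 + a * class_inner ?n ?c w w k / ?x
        = (if k = ?c u \<or> k = ?c v then (s + S) / s else (s + p) / s)"
      by (simp only: form lessThan_iff split: if_split) simp
  qed
  also have "\<dots> = ((s + S) / s)\<^sup>2 * ((s + p) / s) ^ (t - 2)"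
    using cuv uv by (intro prod_two_special) auto
  also have "?x ^ ?n * (((s + S) / s)\<^sup>2 * ((s + p) / s) ^ (t - 2))
      = a ^ ?n * s ^ (?n - t - 2) * (s + p) ^ (t - 3) * (s\<^sup>2 * (s + S)\<^sup>2 * (s + p))"
  proof -
    have "t * 2 \<le> t * p"
      using p by (intro mult_left_mono) auto
    then have "?n = (?n - t - 2) + (t - 2) + 2 + 2"
      using t by linarith
    then have "s ^ ?n = s ^ (?n - t - 2) * s ^ (t - 2) * (s * s) * (s * s)"
      by (metis power_add power2_eq_square)
    moreover have "t - 2 = Suc (t - 3)"
      using t by simp
    then have "(s + p) ^ (t - 2) = (s + p) ^ (t - 3) * (s + p)"
      by simp
    ultimately show ?thesis
      using s by (simp add: power_mult_distrib power_divide power2_eq_square)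
  qed
  also have "a ^ ?n * s ^ (?n - t - 2) * (s + p) ^ (t - 3) * (s\<^sup>2 * (s + S)\<^sup>2 * (s + p))
      * ((s\<^sup>2 + m * s - B * m)
        * (s ^ 3 - (d - m - 2) * s\<^sup>2 - (B * (2 * d - m - 2) + m * d) * s - B * m * d)
        / (s\<^sup>2 * (s + S)\<^sup>2 * (s + p)))
      = a ^ ?n * s ^ (?n - t - 2) * (s + p) ^ (t - 3) * (s\<^sup>2 + m * s - B * m)
        * (s ^ 3 - (d - m - 2) * s\<^sup>2 - (B * (2 * d - m - 2) + m * d) * s - B * m * d)"
  proof -
    have cancel: "A * Q * (q * g / Q) = A * q * g" if "Q \<noteq> 0" for A Q q g :: real
      using that by simp
    have "s\<^sup>2 * (s + S)\<^sup>2 * (s + p) \<noteq> 0"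
      using s S by (auto simp: add_nonneg_eq_0_iff)
    then show ?thesis
      by (rule cancel)
  qed
  finally show ?thesis
    by (simp only: a_def)
qed

section \<open>Energy after deletion of an edge\<close>

text \<open>The cubic is negative at \<open>0\<close>, has the value \<open>2 * m\<^sup>2 + B * m * (d - m - 2) > 0\<close> at \<open>- m\<close>, and has the sign of \<open>s\<close> far out, so the
  intermediate value theorem gives a root in each of the intervals cut out by \<open>- m\<close> and \<open>0\<close>.\<close>

lemma cubic_factorization:
  fixes m d B :: real
  assumes m: "m > 0" and d: "d \<ge> 2 * m + 2" and B: "B > 0"
  obtains l1 l2 l3 where "l1 > 0" "l2 < 0" "l3 < 0"
    "l1 + l2 + l3 = d - m - 2"
    "\<And>s. s ^ 3 - (d - m - 2) * s\<^sup>2 - (B * (2 * d - m - 2) + m * d) * s - B * m * d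
      = (s - l1) * (s - l2) * (s - l3)"
proof -
  define b c e where "b = d - m - 2" and "c = B * (2 * d - m - 2) + m * d" and "e = B * m * d"
  define g where "g = (\<lambda>s. s ^ 3 - b * s\<^sup>2 - c * s - e)"
  have pos: "b > 0" "c > 0" "e > 0"
    using m d B by (auto simp: b_def c_def e_def intro!: add_pos_pos mult_pos_pos)
  have cont: "isCont g s" for s
    unfolding g_def by (intro continuous_intros)
  have g0: "g 0 < 0"
    using pos by (simp add: g_def)
  have "g (- m) = 2 * m\<^sup>2 + B * m * (d - m - 2)"
    by (simp add: g_def b_def c_def e_def power2_eq_square power3_eq_cube algebra_simps)
  moreover have "B * m * (d - m - 2) > 0"
    using m d B by simp
  ultimately have gm: "g (- m) > 0"
    using m by (metis add_pos_pos zero_less_numeral zero_less_mult_iff zero_less_power)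
  \<comment> \<open>\<open>R\<close> exceeds the sum of the absolute values of all coefficients, so the leading term dominates
    outside \<open>[-R, R]\<close>.\<close>
  define R where "R = m + b + c + e + 1"
  have R: "R \<ge> 1" "R > m"
    using m pos by (auto simp: R_def)
  have R2: "R \<le> R\<^sup>2" 
    using R by (simp add: power2_eq_square)
  have "b * R\<^sup>2 + c * R + e \<le> b * R\<^sup>2 + c * R\<^sup>2 + e * R\<^sup>2"
    using R R2 pos by (intro add_mono mult_left_mono) auto
  also have "\<dots> < R * R\<^sup>2"
    using R pos m by (subst distrib_right[symmetric])+ (intro mult_strict_right_mono, auto simp: R_def)
  finally have gR: "g R > 0"
    by (simp add: g_def power3_eq_cube power2_eq_square)
  have "- (R ^ 3) + c * R \<le> - (R ^ 3) + c * R\<^sup>2"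
    using R2 pos by simp
  also have "\<dots> = R\<^sup>2 * (c - R)"
    by (simp add: power3_eq_cube power2_eq_square algebra_simps)
  also have "\<dots> \<le> 0"
    using m pos by (intro mult_nonneg_nonpos) (auto simp: R_def)
  finally have "- (R ^ 3) + c * R \<le> 0" .
  moreover have "g (- R) = (- (R ^ 3) + c * R) - b * R\<^sup>2 - e"
    by (simp add: g_def power3_eq_cube power2_eq_square algebra_simps)
  moreover have "b * R\<^sup>2 \<ge> 0"
    using pos by simp
  ultimately have gmR: "g (- R) < 0"
    using pos by linarith
  obtain l1 where l1: "0 \<le> l1" "l1 \<le> R" "g l1 = 0"
    using IVT[of g 0 0 R] g0 gR R cont by force
  obtain l2 where l2: "- m \<le> l2" "l2 \<le> 0" "g l2 = 0"
    using IVT2[of g 0 0 "- m"] g0 gm m cont by force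
  obtain l3 where l3: "- R \<le> l3" "l3 \<le> - m" "g l3 = 0"
    using IVT[of g "- R" 0 "- m"] gmR gm R cont by force
  have neq: "l1 \<noteq> 0" "l2 \<noteq> 0" "l2 \<noteq> - m" "l3 \<noteq> - m"
    using g0 gm l1 l2 l3 by auto
  then have ord: "l1 > 0" "l2 < 0" "l3 < 0" "l1 \<noteq> l2" "l1 \<noteq> l3" "l2 \<noteq> l3"
    using l1 l2 l3 m by auto
  \<comment> \<open>Divided differences at the three distinct roots yield Vieta's relations.\<close>
  have d12: "(l1\<^sup>2 + l1 * l2 + l2\<^sup>2) - b * (l1 + l2) - c = 0"
  proof -
    have "(l1 - l2) * ((l1\<^sup>2 + l1 * l2 + l2\<^sup>2) - b * (l1 + l2) - c) = g l1 - g l2"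
      by (simp add: g_def power3_eq_cube power2_eq_square algebra_simps)
    then show ?thesis
      using l1 l2 ord by simp
  qed
  have d13: "(l1\<^sup>2 + l1 * l3 + l3\<^sup>2) - b * (l1 + l3) - c = 0"
  proof -
    have "(l1 - l3) * ((l1\<^sup>2 + l1 * l3 + l3\<^sup>2) - b * (l1 + l3) - c) = g l1 - g l3"
      by (simp add: g_def power3_eq_cube power2_eq_square algebra_simps)
    then show ?thesis
      using l1 l3 ord by simp
  qed
  have "(l2 - l3) * (l1 + l2 + l3 - b) = 0"
    using d12 d13 by (simp add: power2_eq_square algebra_simps)
  then have sum: "l1 + l2 + l3 = b"
    using ord by simp
  have c: "c = - (l1 * l2 + l1 * l3 + l2 * l3)"
    using d12 unfolding sum[symmetric] by (simp add: power2_eq_square algebra_simps)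
  have e: "e = l1 * l2 * l3"
    using l1(3) unfolding g_def c sum[symmetric] by (simp add: power2_eq_square power3_eq_cube algebra_simps)
  have "g s = (s - l1) * (s - l2) * (s - l3)" for s
    unfolding g_def c e sum[symmetric] by (simp add: power2_eq_square power3_eq_cube algebra_simps)
  then show ?thesis
    using that[of l1 l2 l3] ord sum by (simp add: g_def b_def c_def e_def)
qed

text \<open>The eigenvalues \<open>- (m + \<nu>)\<close>, \<open>l2\<close>, \<open>l3\<close> and \<open>- p\<close> are negative, and the sum
  \<open>l + l2 + l3 = d - m - 2\<close> eliminates the unknown \<open>l2\<close> and \<open>l3\<close> from the sum of absolute values.
  On the positive axis the quadratic and the cubic each change sign only once, which locates
  \<open>\<nu>\<close> and \<open>l\<close> by evaluation at rational points.\<close>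

lemma ISI_energy_multipartite_delete:
  fixes t p :: nat and d m B :: real
  defines "d \<equiv> real ((t - 1) * p)" and "m \<equiv> real p - 1" and "B \<equiv> ((2 * d - 2) / (2 * d - 1))\<^sup>2"
  assumes t: "t \<ge> 3" and p: "p \<ge> 2" and e: "e \<in> multipartite_edges t p"
  obtains \<nu> l where
    "ISI_energy (t * p) (multipartite_edges t p - {e}) = d * (\<nu> + l)"
    "\<nu>\<^sup>2 + m * \<nu> - B * m = 0"
    "\<And>x. x > 0 \<Longrightarrow> x\<^sup>2 + m * x - B * m < 0 \<longleftrightarrow> x < \<nu>"
    "\<And>x. x > 0 \<Longrightarrow> x ^ 3 - (d - m - 2) * x\<^sup>2 - (B * (2 * d - m - 2) + m * d) * x - B * m * d < 0
      \<longleftrightarrow> x < l"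
proof -
  obtain u v where euv: "e = {u, v}" and uv: "u < t * p" "v < t * p" "u div p \<noteq> v div p"
    using e by (auto simp: multipartite_edges_def)
  have "2 * p \<le> (t - 1) * p"
    using t by (intro mult_le_mono1) auto
  then have d: "d \<ge> 2 * real p"
    unfolding d_def by (metis of_nat_le_iff of_nat_mult of_nat_numeral)
  then have m: "m > 0" and d2: "d \<ge> 2 * m + 2" and d4: "d \<ge> 4"
    using p by (auto simp: m_def)
  have B: "B > 0"
    using d4 by (simp add: B_def)
  obtain l1 l2 l3 where l: "l1 > 0" "l2 < 0" "l3 < 0" "l1 + l2 + l3 = d - m - 2"
    and cubic: "\<And>s. s ^ 3 - (d - m - 2) * s\<^sup>2 - (B * (2 * d - m - 2) + m * d) * s - B * m * d
      = (s - l1) * (s - l2) * (s - l3)"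
    using cubic_factorization[OF m d2 B] by metis
  define \<nu> where "\<nu> = (- m + sqrt (m\<^sup>2 + 4 * B * m)) / 2"
  have "sqrt (m\<^sup>2 + 4 * B * m) > sqrt (m\<^sup>2)"
    using m B by (intro real_sqrt_less_mono) simp
  then have \<nu>: "\<nu> > 0"
    using m by (simp add: \<nu>_def)
  have "2 * \<nu> + m = sqrt (m\<^sup>2 + 4 * B * m)"
    by (simp add: \<nu>_def field_simps)
  then have "(2 * \<nu> + m)\<^sup>2 = m\<^sup>2 + 4 * B * m"
    using m B by simp
  then have root: "\<nu>\<^sup>2 + m * \<nu> - B * m = 0"
    by (simp add: power2_eq_square algebra_simps)
  have quad: "s\<^sup>2 + m * s - B * m = (s - \<nu>) * (s + m + \<nu>)" for s
    using root by (simp add: power2_eq_square algebra_simps)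
  let ?L = "{#\<nu>, - (m + \<nu>), l1, l2, l3#} + replicate_mset (t - 3) (- real p)
    + replicate_mset (t * p - t - 2) 0"
  let ?A = "ISI_matrix (t * p) (multipartite_edges t p - {e})"
  have "poly (char_poly ?A) (d / 2 * s) = (d / 2) ^ size ?L * (\<Prod>l\<in>#?L. s - l)" if "s > 0" for s
  proof -
    \<comment> \<open>Since \<open>t * p \<ge> 2 * t \<ge> t + 2\<close>, the truncated subtractions are exact.\<close>
    have "t * 2 \<le> t * p"
      using p by (intro mult_left_mono) auto
    then have "5 + (t - 3) + (t * p - t - 2) = t * p"
      using t by linarith
    then have size: "size ?L = t * p"
      by simp
    have "(\<Prod>l\<in>#?L. s - l) = s ^ (t * p - t - 2) * (s + p) ^ (t - 3) * ((s - \<nu>) * (s + m + \<nu>))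
        * ((s - l1) * (s - l2) * (s - l3))"
      by (simp add: mult_ac add_ac)
    then show ?thesis
      using poly_char_poly_multipartite_delete[OF t p uv that, folded d_def m_def, folded B_def]
      unfolding size euv quad cubic by (simp only: mult.assoc)
  qed
  then have "ISI_energy (t * p) (multipartite_edges t p - {e}) = d / 2 * (\<Sum>l\<in>#?L. \<bar>l\<bar>)"
    unfolding ISI_energy_def using d4 by (intro matrix_energy_eq_sum_roots) auto
  also have "(\<Sum>l\<in>#?L. \<bar>l\<bar>) = 2 * \<nu> + m + l1 - l2 - l3 + (real t - 3) * p"
    using \<nu> l m t by (simp add: of_nat_diff)
  also have "\<dots> = 2 * (\<nu> + l1)"
  proof -
    have "d = real t * p - p"
      using t by (simp add: d_def of_nat_diff left_diff_distrib)
    then show ?thesis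
      using l(4) by (simp add: m_def left_diff_distrib)
  qed
  also have "d / 2 * (2 * (\<nu> + l1)) = d * (\<nu> + l1)"
    by simp
  finally have "ISI_energy (t * p) (multipartite_edges t p - {e}) = d * (\<nu> + l1)" .
  then show ?thesis
  proof (rule that[OF _ root])
    fix x :: real assume "x > 0"
    then show "x\<^sup>2 + m * x - B * m < 0 \<longleftrightarrow> x < \<nu>"
      unfolding quad using \<nu> m by (auto simp: mult_less_0_iff)
    have "(x - l2) * (x - l3) > 0"
      using \<open>x > 0\<close> l by simp
    with mult_less_0_iff[of "x - l1" "(x - l2) * (x - l3)"]
    show "x ^ 3 - (d - m - 2) * x\<^sup>2 - (B * (2 * d - m - 2) + m * d) * x - B * m * d < 0
        \<longleftrightarrow> x < l1"
      unfolding cubic unfolding mult.assoc by argo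
  qed
qed

section \<open>Comparison of the energies\<close>

text \<open>The relation \<open>\<nu>\<^sup>2 = B * m - m * \<nu>\<close> reduces the value of the cubic at \<open>d - \<nu>\<close> to an expression
  linear in \<open>\<nu>\<close>.\<close>

lemma cubic_at_reflected_root:
  fixes m d B \<nu> :: real
  assumes "\<nu>\<^sup>2 + m * \<nu> - B * m = 0"
  shows "(d - \<nu>) ^ 3 - (d - m - 2) * (d - \<nu>)\<^sup>2 - (B * (2 * d - m - 2) + m * d) * (d - \<nu>) - B * m * d
    = 2 * d\<^sup>2 * (1 - B) + 2 * B * (m + 1) * (m + d)
      - \<nu> * ((d + m) * (d + 2 * m) + 4 * d + 2 * m - 2 * B * (d - m - 1))"
proof -
  \<comment> \<open>Division with remainder by the quadratic has the quotient \<open>2 * d + 2 * m + 2 - \<nu>\<close>.\<close>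
  have "(d - \<nu>) ^ 3 - (d - m - 2) * (d - \<nu>)\<^sup>2 - (B * (2 * d - m - 2) + m * d) * (d - \<nu>) - B * m * d
    - (2 * d\<^sup>2 * (1 - B) + 2 * B * (m + 1) * (m + d)
      - \<nu> * ((d + m) * (d + 2 * m) + 4 * d + 2 * m - 2 * B * (d - m - 1)))
    = (\<nu>\<^sup>2 + m * \<nu> - B * m) * (2 * d + 2 * m + 2 - \<nu>)"
    by (simp add: power2_eq_square power3_eq_cube algebra_simps)
  then show ?thesis
    using assms by simp
qed

text \<open>For \<open>d \<ge> 6\<close> one has \<open>100 / 121 \<le> B \<le> 1 - 1 / d\<close>. Evaluating the quadratic at \<open>0.53\<close> (for
  \<open>m = 1\<close>) or \<open>0.62\<close> (for \<open>m \<ge> 2\<close>) shows that \<open>\<nu>\<close> is larger. For large \<open>d\<close> the right-hand side is at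
  least about \<open>0.62 * d\<^sup>2\<close>, or \<open>0.53 * d\<^sup>2\<close> for \<open>m = 1\<close>, plus \<open>1.86 * m * d\<close> and \<open>1.24 * m\<^sup>2\<close>, against
  roughly \<open>2 * d + 2 * (m + 1) * (m + d)\<close> on the left, where \<open>m\<close> is less than \<open>d / 2\<close>. The bounds
  \<open>0.53\<close> and \<open>0.62\<close> are nearly as large as possible for \<open>d = 6\<close>.\<close>

lemma reflected_root_bound:
  fixes d m B \<nu> :: real
  defines "B \<equiv> ((2 * d - 2) / (2 * d - 1))\<^sup>2"
  assumes d: "d \<ge> 6" "d \<ge> 2 * m + 2" and m: "m = 1 \<or> m \<ge> 2"
    and \<nu>: "\<And>x. x > 0 \<Longrightarrow> x\<^sup>2 + m * x - B * m < 0 \<Longrightarrow> x < \<nu>"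
  shows "2 * d\<^sup>2 * (1 - B) + 2 * B * (m + 1) * (m + d)
    < \<nu> * ((d + m) * (d + 2 * m) + 4 * d + 2 * m - 2 * B * (d - m - 1))"
proof -
  have dd: "d * d \<ge> 6 * d"
    using d by (intro mult_right_mono) auto
  have "2 * d - 1 \<noteq> 0"
    using d by simp
  then have B1: "1 - B = (4 * d - 3) / (2 * d - 1)\<^sup>2"
    by (simp add: B_def power_divide field_simps) (simp add: power2_eq_square algebra_simps)
  have pos: "(2 * d - 1)\<^sup>2 > 0"
    using d by simp
  have Bd: "B * d \<le> d - 1"
  proof -
    have "1 \<le> (4 * d - 3) * d / (2 * d - 1)\<^sup>2"
      using d pos by (simp add: pos_le_divide_eq power2_eq_square algebra_simps)
    then have "1 \<le> (1 - B) * d"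
      by (simp add: B1)
    then show ?thesis
      by (simp add: algebra_simps)
  qed
  have "B * d \<le> 1 * d"
    using Bd by simp
  then have B_le: "B \<le> 1"
    using d mult_le_cancel_right_pos[of d B 1] by simp
  have B_ge: "B \<ge> 100 / 121"
  proof -
    have "10 / 11 \<le> (2 * d - 2) / (2 * d - 1)"
      using d by (simp add: field_simps)
    then have "(10 / 11)\<^sup>2 \<le> B"
      unfolding B_def by (rule power_mono) simp
    then show ?thesis
      by (simp add: power2_eq_square)
  qed
  have loss: "2 * d\<^sup>2 * (1 - B) \<le> 21 / 10 * d"
  proof -
    have "2 * d * (4 * d - 3) \<le> 21 / 10 * (2 * d - 1)\<^sup>2"
      using dd by (simp add: power2_eq_square algebra_simps)
    then have "2 * d * (1 - B) \<le> 21 / 10"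
      unfolding B1 using pos by (simp add: pos_divide_le_eq)
    then have "2 * d * (1 - B) * d \<le> 21 / 10 * d"
      using d by (intro mult_right_mono) auto
    then show ?thesis
      by (simp add: power2_eq_square mult_ac)
  qed
  let ?K = "(d + m) * (d + 2 * m) + 4 * d + 2 * m - 2 * B * (d - m - 1)"
  have m1: "m \<ge> 1"
    using m by auto
  have "B * (d - m - 1) \<le> 1 * (d - m - 1)"
    using B_le d m1 by (intro mult_right_mono) auto
  then have K: "?K \<ge> (d + m) * (d + 2 * m) + 2 * d + 4 * m + 2"
    by simp
  then have K_pos: "?K > 0"
    using d m1 by (intro less_le_trans[OF _ K]) (auto intro!: add_pos_pos mult_pos_pos)
  show ?thesis
    using m
  proof
    assume [simp]: "m = 1"
    have "53 / 100 < \<nu>"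
      using B_ge by (intro \<nu>) (auto simp: power2_eq_square)
    then have "53 / 100 * ?K < \<nu> * ?K"
      using K_pos by (intro mult_strict_right_mono)
    moreover have "2 * d\<^sup>2 * (1 - B) + 2 * B * (m + 1) * (m + d) < 53 / 100 * ?K"
    proof -
      have K_eq: "?K = d * d + 7 * d + 4 - 2 * (B * d) + 4 * B"
        by (simp add: algebra_simps)
      have gain_eq: "2 * B * (m + 1) * (m + d) = 4 * B + 4 * (B * d)"
        by (simp add: algebra_simps)
      \<comment> \<open>The parabola lies above its tangent at the smallest admissible \<open>d\<close>, which is \<open>6\<close>.\<close>
      have "d * d \<ge> 12 * d - 36"
        using zero_le_square[of "d - 6"] by (simp add: algebra_simps)
      then show ?thesis
        unfolding K_eq gain_eq using loss Bd B_le d(1) by argo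
    qed
    ultimately show ?thesis
      by (rule less_trans[rotated])
  next
    assume m2: "m \<ge> 2"
    have "100 / 121 * m \<le> B * m"
      using B_ge m2 by (intro mult_right_mono) auto
    then have "(62 / 100)\<^sup>2 + m * (62 / 100) - B * m < 0"
      unfolding power2_eq_square using m2 by linarith
    then have "62 / 100 < \<nu>"
      by (intro \<nu>) auto
    then have "62 / 100 * ?K < \<nu> * ?K"
      using K_pos by (intro mult_strict_right_mono)
    moreover have "62 / 100 * ((d + m) * (d + 2 * m) + 2 * d + 4 * m + 2) \<le> 62 / 100 * ?K"
      using K by (intro mult_left_mono) auto
    moreover have "2 * B * (m + 1) * (m + d) \<le> 2 * (m + 1) * (m + d)"
      using B_le m2 d by (intro mult_right_mono) auto
    moreover have "21 / 10 * d + 2 * (m + 1) * (m + d)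
        \<le> 62 / 100 * ((d + m) * (d + 2 * m) + 2 * d + 4 * m + 2)"
    proof -
      have "m * d \<le> (d / 2 - 1) * d"
        using d by (intro mult_right_mono) auto
      then have md: "m * d \<le> d * d / 2 - d"
        by (simp add: algebra_simps)
      have "m * m \<le> (d / 2 - 1) * (d / 2 - 1)"
        using d m2 by (intro mult_mono) auto
      then have mm: "m * m \<le> d * d / 4 - d + 1"
        by (simp add: algebra_simps)
      have loss_eq: "2 * (m + 1) * (m + d) = 2 * (m * m) + 2 * (m * d) + 2 * m + 2 * d"
        by (simp add: algebra_simps)
      have gain_eq: "(d + m) * (d + 2 * m) = d * d + 3 * (m * d) + 2 * (m * m)"
        by (simp add: algebra_simps)
      show ?thesis
        unfolding loss_eq gain_eq using md mm dd d m2 by argo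
    qed
    ultimately show ?thesis
      using loss by linarith
  qed
qed

text \<open>Since \<open>B \<le> 1\<close>, the quadratic is positive at \<open>1\<close>, so \<open>\<nu> \<le> 1\<close>. Hence \<open>d - \<nu>\<close> is positive, and the
  sign of the cubic there decides whether it lies below \<open>l\<close>.\<close>

lemma ISI_energy_increases:
  assumes t: "t \<ge> 3" and p: "p \<ge> 2" and tp: "(t, p) \<noteq> (3, 2)" and e: "e \<in> multipartite_edges t p"
  shows "ISI_energy (t * p) (multipartite_edges t p - {e}) > ISI_energy (t * p) (multipartite_edges t p)"
proof -
  define d m B where "d = real ((t - 1) * p)" and "m = real p - 1"
    and "B = ((2 * d - 2) / (2 * d - 1))\<^sup>2"
  obtain \<nu> l where energy: "ISI_energy (t * p) (multipartite_edges t p - {e}) = d * (\<nu> + l)"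
    and root: "\<nu>\<^sup>2 + m * \<nu> - B * m = 0"
    and \<nu>: "\<And>x. x > 0 \<Longrightarrow> x\<^sup>2 + m * x - B * m < 0 \<longleftrightarrow> x < \<nu>"
    and l: "\<And>x. x > 0 \<Longrightarrow> x ^ 3 - (d - m - 2) * x\<^sup>2 - (B * (2 * d - m - 2) + m * d) * x - B * m * d < 0
      \<longleftrightarrow> x < l"
    using ISI_energy_multipartite_delete[OF t p e, folded d_def m_def, folded B_def] by metis
  \<comment> \<open>This is where \<open>(3, 2)\<close>, for which \<open>d = 4\<close>, is excluded.\<close>
  have "6 \<le> (t - 1) * p"
  proof (cases "t = 3")
    case False
    then have "3 * 2 \<le> (t - 1) * p"
      using t p by (intro mult_mono) auto
    then show ?thesis
      by simp
  qed (use p tp in auto)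
  then have d6: "d \<ge> 6"
    by (simp add: d_def del: of_nat_mult)
  have "2 * p \<le> (t - 1) * p"
    using t by (intro mult_le_mono1) auto
  then have "d \<ge> 2 * real p"
    unfolding d_def by (metis of_nat_le_iff of_nat_mult of_nat_numeral)
  then have dm: "d \<ge> 2 * m + 2"
    by (simp add: m_def)
  have m: "m = 1 \<or> m \<ge> 2"
    using p by (cases "p = 2") (auto simp: m_def)
  have B_le: "B \<le> 1"
    using d6 by (auto simp: B_def intro!: power_le_one)
  have "B * m \<le> 1 * m"
    using B_le m by (intro mult_right_mono) auto
  then have "\<not> 1 < \<nu>"
    using \<nu>[of 1] by simp
  then have "d - \<nu> > 0"
    using d6 by linarith
  moreover have "(d - \<nu>) ^ 3 - (d - m - 2) * (d - \<nu>)\<^sup>2 - (B * (2 * d - m - 2) + m * d) * (d - \<nu>) - B * m * d < 0"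
    unfolding cubic_at_reflected_root[OF root]
    using reflected_root_bound[OF d6 dm m, folded B_def] \<nu> by fastforce
  ultimately have "d - \<nu> < l"
    using l by blast
  then have "d * d < d * (\<nu> + l)"
    using d6 by (intro mult_strict_left_mono) auto
  moreover have "ISI_energy (t * p) (multipartite_edges t p) = d * d"
    using ISI_energy_multipartite[of t p] t p by (simp add: d_def power2_eq_square)
  ultimately show ?thesis
    by (simp add: energy)
qed

text \<open>Here \<open>d = 4\<close>, \<open>m = 1\<close> and \<open>B = 36 / 49\<close>; the positive roots are \<open>\<nu> \<approx> 0.492317427\<close> and
  \<open>l \<approx> 3.461820360\<close>.\<close>

lemma ISI_energy_octahedron_delete:
  assumes e: "e \<in> multipartite_edges 3 2"
  shows "15.8165511 < ISI_energy (3 * 2) (multipartite_edges 3 2 - {e})"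
    and "ISI_energy (3 * 2) (multipartite_edges 3 2 - {e}) < 15.8165513"
proof -
  obtain \<nu> l where energy: "ISI_energy (3 * 2) (multipartite_edges 3 2 - {e}) = 4 * (\<nu> + l)"
    and \<nu>: "\<And>x. x > 0 \<Longrightarrow> x\<^sup>2 + x - 36 / 49 < 0 \<longleftrightarrow> x < \<nu>"
    and l: "\<And>x. x > 0 \<Longrightarrow> x ^ 3 - x\<^sup>2 - 376 / 49 * x - 144 / 49 < 0 \<longleftrightarrow> x < l"
    using ISI_energy_multipartite_delete[of 3 2 e, OF _ _ e]
    by (simp add: power_divide algebra_simps) metis
  have "0.49231742 < \<nu>" "\<not> 0.49231743 < \<nu>"
    by (subst \<nu>[symmetric]; simp add: power2_eq_square)+
  moreover have "3.46182036 < l" "\<not> 3.46182037 < l"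
    by (subst l[symmetric]; simp add: power2_eq_square power3_eq_cube)+
  ultimately show "15.8165511 < ISI_energy (3 * 2) (multipartite_edges 3 2 - {e})"
    "ISI_energy (3 * 2) (multipartite_edges 3 2 - {e}) < 15.8165513"
    unfolding energy by simp_all
qed

theorem theorem3p10:
  shows
    "(\<forall>t p e. t \<ge> 3 \<and> p \<ge> 2 \<and> e \<in> multipartite_edges t p \<and> (t, p) \<noteq> (3, 2) \<longrightarrow>
        ISI_energy (t * p) (multipartite_edges t p - {e})
          > ISI_energy (t * p) (multipartite_edges t p)) \<and>
     (\<forall>e. e \<in> multipartite_edges 3 2 \<longrightarrow>
        \<bar>ISI_energy (3 * 2) (multipartite_edges 3 2 - {e}) - 15.816551\<bar> \<le> 5 / 10 ^ 7 \<and>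
        ISI_energy (3 * 2) (multipartite_edges 3 2 - {e}) < 16) \<and>
     16 = ISI_energy (3 * 2) (multipartite_edges 3 2) \<and>
     (\<forall>p e. p \<ge> 2 \<and> e \<in> multipartite_edges 3 p \<longrightarrow>
        (p = 2 \<longrightarrow>
          ISI_energy (3 * p) (multipartite_edges 3 p - {e})
            < ISI_energy (3 * p) (multipartite_edges 3 p)) \<and>
        (p \<ge> 3 \<longrightarrow>
          ISI_energy (3 * p) (multipartite_edges 3 p - {e})
            > ISI_energy (3 * p) (multipartite_edges 3 p))) \<and>
     (\<forall>t p e. t \<ge> 4 \<and> p \<ge> 2 \<and> e \<in> multipartite_edges t p \<longrightarrow>
        ISI_energy (t * p) (multipartite_edges t p - {e})
          > ISI_energy (t * p) (multipartite_edges t p))"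
proof -
  have full: "ISI_energy (3 * 2) (multipartite_edges 3 2) = 16"
    using ISI_energy_multipartite[of 3 2] by simp
  have approx: "\<bar>ISI_energy (3 * 2) (multipartite_edges 3 2 - {e}) - 15.816551\<bar> \<le> 5 / 10 ^ 7"
    and less: "ISI_energy (3 * 2) (multipartite_edges 3 2 - {e}) < 16"
    if "e \<in> multipartite_edges 3 2" for e
    using ISI_energy_octahedron_delete[OF that] by (simp_all add: abs_le_iff)
  show ?thesis
  proof (intro conjI allI impI; (elim conjE)?)
    fix p e assume "e \<in> multipartite_edges 3 p" "p = 2"
    then show "ISI_energy (3 * p) (multipartite_edges 3 p - {e}) < ISI_energy (3 * p) (multipartite_edges 3 p)"
      using full less by simp
  next
    fix p e assume "e \<in> multipartite_edges 3 p" "p \<ge> 3"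
    then show "ISI_energy (3 * p) (multipartite_edges 3 p - {e}) > ISI_energy (3 * p) (multipartite_edges 3 p)"
      by (intro ISI_energy_increases) auto
  qed (use full approx less ISI_energy_increases in auto)
qed

end
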